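(* For a generalized network code $(\mathcal{C},F)$, $d_2^{\min}\ge\left\lceil\frac{d_0^{\min}}{2}\right\rceil$.
   Context: A generalized network channel consists of a set $\mathcal{C}$ of codewords, a set $\mathcal{E}$ of errors with a distinguished element $0$ (the zero error), an output set $\mathcal{Y}$, a weight $w:\mathcal{E}\to\mathbb{Z}_{\ge 0}$ with $w(z)=0$ if and only if $z=0$, and a transfer function $F:\mathcal{C}\times\mathcal{E}\to\mathcal{Y}$ such that $F(x,0)\ne F(x',0)$ whenever $x\neq x'$ in $\mathcal{C}$. The sets are otherwise arbitrary. The pair $(\mathcal{C},F)$ is called a generalized network code; $|\mathcal{C}|\ge 2$ is assumed. For $x\in\mathcal{C}$ and an integer $c\ge 0$, the decoding ball is $\Phi(x,c)=\{F(x,z): z\in\mathcal{E},\ w(z)\le c\}$. For $x_1,x_2\in\mathcal{C}$ (all $c$'s are nonnegative integers, and a minimum over the empty set is $+\infty$, with $\lceil+\infty/2\rceil=+\infty$): $D_0(x_1,x_2)=\min\{c_1+c_2 : |c_1-c_2|\le 1,\ \Phi(x_1,c_1)\cap\Phi(x_2,c_2)\ne\emptyset\}$; $D_2(x_1,x_2)=\min\{c_1+c_2 : \Phi(x_1,c_1)\cap\Phi(x_2,c_2)\neq\emptyset\}$; and $d_i^{\min}=\min_{x_1,x_2\in\mathcal{C},\,x_1\ne x_2}D_i(x_1,x_2)$ for $i=0,2$. *)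

theory Defs
  imports Complex_Main "HOL-Library.Extended_Nat"
begin

locale generalized_network_code =
  fixes C :: "'c set"
    and E :: "'e set"
    and zero_err :: 'e
    and Y :: "'y set"
    and w :: "'e \<Rightarrow> nat"
    and F :: "'c \<Rightarrow> 'e \<Rightarrow> 'y"
  assumes zero_err_in: "zero_err \<in> E"
    and weight_eq_zero_iff: "z \<in> E \<Longrightarrow> w z = 0 \<longleftrightarrow> z = zero_err"
    and transfer_in: "x \<in> C \<Longrightarrow> z \<in> E \<Longrightarrow> F x z \<in> Y"
    and transfer_zero_err_inj:
      "x \<in> C \<Longrightarrow> x' \<in> C \<Longrightarrow> x \<noteq> x' \<Longrightarrow> F x zero_err \<noteq> F x' zero_err"
    (* an infinite code has card C = 0 in HOL, and is allowed *)
    and card_code: "finite C \<Longrightarrow> 2 \<le> card C"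

definition decoding_ball ::
  "'e set \<Rightarrow> ('e \<Rightarrow> nat) \<Rightarrow> ('c \<Rightarrow> 'e \<Rightarrow> 'y) \<Rightarrow> 'c \<Rightarrow> nat \<Rightarrow> 'y set" where
  "decoding_ball E w F x c = {F x z | z. z \<in> E \<and> w z \<le> c}"

(* On enat, Inf of a nonempty set is its minimum and Inf {} is infinity,
   which is the intended convention for minima over the empty set. *)

definition D0 ::
  "'e set \<Rightarrow> ('e \<Rightarrow> nat) \<Rightarrow> ('c \<Rightarrow> 'e \<Rightarrow> 'y) \<Rightarrow> 'c \<Rightarrow> 'c \<Rightarrow> enat" where
  "D0 E w F x1 x2 = Inf {enat (c1 + c2) | c1 c2.
     \<bar>int c1 - int c2\<bar> \<le> 1 \<and>
     decoding_ball E w F x1 c1 \<inter> decoding_ball E w F x2 c2 \<noteq> {}}"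

definition D2 ::
  "'e set \<Rightarrow> ('e \<Rightarrow> nat) \<Rightarrow> ('c \<Rightarrow> 'e \<Rightarrow> 'y) \<Rightarrow> 'c \<Rightarrow> 'c \<Rightarrow> enat" where
  "D2 E w F x1 x2 = Inf {enat (c1 + c2) | c1 c2.
     decoding_ball E w F x1 c1 \<inter> decoding_ball E w F x2 c2 \<noteq> {}}"

definition min_over_pairs :: "'c set \<Rightarrow> ('c \<Rightarrow> 'c \<Rightarrow> enat) \<Rightarrow> enat" where
  "min_over_pairs C D = Inf {D x1 x2 | x1 x2. x1 \<in> C \<and> x2 \<in> C \<and> x1 \<noteq> x2}"

definition d0_min ::
  "'c set \<Rightarrow> 'e set \<Rightarrow> ('e \<Rightarrow> nat) \<Rightarrow> ('c \<Rightarrow> 'e \<Rightarrow> 'y) \<Rightarrow> enat" where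
  "d0_min C E w F = min_over_pairs C (D0 E w F)"

definition d2_min ::
  "'c set \<Rightarrow> 'e set \<Rightarrow> ('e \<Rightarrow> nat) \<Rightarrow> ('c \<Rightarrow> 'e \<Rightarrow> 'y) \<Rightarrow> enat" where
  "d2_min C E w F = min_over_pairs C (D2 E w F)"

definition ceil_half :: "enat \<Rightarrow> enat" where
  "ceil_half d = (case d of enat n \<Rightarrow> enat (nat \<lceil>real n / 2\<rceil>) | \<infinity> \<Rightarrow> \<infinity>)"

end

theory Submission imports Defs begin

lemma decoding_ball_mono:
  "c \<le> c' \<Longrightarrow> decoding_ball E w F x c \<subseteq> decoding_ball E w F x c'"
  unfolding decoding_ball_def by fastforce

text \<open>Since \<open>n\<close> is an integer with \<open>d / 2\<close> at most \<open>n\<close>,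
  rounding up cannot exceed it. The hypothesis rules out \<open>d = \<infinity>\<close>.\<close>

lemma ceil_half_le_enat:
  assumes "d \<le> enat (2 * n)"
  shows "ceil_half d \<le> enat n"
proof (cases d)
  case (enat k)
  then have "\<lceil>real k / 2\<rceil> \<le> int n"
    using assms by (simp add: ceiling_le_iff)
  then show ?thesis
    using enat by (simp add: ceil_half_def nat_le_iff del: ceiling_le_iff)
qed (use assms in simp)

lemma D0_le_if_balls_intersect:
  assumes "decoding_ball E w F x1 c1 \<inter> decoding_ball E w F x2 c2 \<noteq> {}"
  shows "D0 E w F x1 x2 \<le> enat (2 * max c1 c2)"
proof -
  let ?m = "max c1 c2"
  have "decoding_ball E w F x1 ?m \<inter> decoding_ball E w F x2 ?m \<noteq> {}"
    using assms decoding_ball_mono[of c1 ?m E w F x1] decoding_ball_mono[of c2 ?m E w F x2]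
    by auto
  then show ?thesis
    \<comment> \<open>Both radii are taken to be \<open>?m\<close>: they differ by 0 \<le> 1 and sum
      to \<open>2 * ?m\<close>.\<close>
    unfolding D0_def by (intro Inf_lower CollectI exI[of _ ?m]) auto
qed

text \<open>If two balls of radii \<open>c\<^sub>1\<close> and \<open>c\<^sub>2\<close> meet, then so do the balls of common radius
  \<open>max c\<^sub>1 c\<^sub>2\<close>; these are admissible for \<open>D\<^sub>0\<close>, and \<open>2 max c\<^sub>1 c\<^sub>2 \<le> 2 (c\<^sub>1 + c\<^sub>2)\<close>.\<close>

theorem corollary5p8:
  fixes C :: "'c set" and E :: "'e set" and zero_err :: 'e and Y :: "'y set"
    and w :: "'e \<Rightarrow> nat" and F :: "'c \<Rightarrow> 'e \<Rightarrow> 'y"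
  assumes "generalized_network_code C E zero_err Y w F"
  shows "d2_min C E w F \<ge> ceil_half (d0_min C E w F)"
proof -
  have "ceil_half (d0_min C E w F) \<le> enat (c1 + c2)"
    if x: "x1 \<in> C" "x2 \<in> C" "x1 \<noteq> x2"
      and meet: "decoding_ball E w F x1 c1 \<inter> decoding_ball E w F x2 c2 \<noteq> {}"
    for x1 x2 c1 c2
  proof (rule ceil_half_le_enat)
    have "d0_min C E w F \<le> D0 E w F x1 x2"
      unfolding d0_min_def min_over_pairs_def using x by (intro Inf_lower) blast
    also have "\<dots> \<le> enat (2 * max c1 c2)"
      using meet by (rule D0_le_if_balls_intersect)
    also have "\<dots> \<le> enat (2 * (c1 + c2))"
      by simp
    finally show "d0_min C E w F \<le> enat (2 * (c1 + c2))" .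
  qed
  \<comment> \<open>Both nested infima are bounded below element by element, so an empty set, with
    infimum \<open>\<infinity>\<close>, is covered as well.\<close>
  then show ?thesis
    unfolding d2_min_def min_over_pairs_def D2_def
    by (safe intro!: Inf_greatest) blast
qed

end
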